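(* For all integers $n,t\geq 1$, the following three finite sums are equal (as rational functions of $q$): $$F_t(n)=G_t(n)=H_t(n),$$ where $$F_t(n)=\sum_{1\leq k_1\leq\cdots\leq k_t\leq n}\frac{q^{k_1+k_2+\cdots+k_t}}{[k_1]_q^2[k_2]_q^2\cdots[k_t]_q^2},$$ $$G_t(n)=\sum_{k=1}^n\frac{(-1)^{k-1}(1+q^k)\,q^{\binom{k}{2}+tk}\,{n\brack k}_q}{[k]_q^{2t}\,{n+k\brack k}_q},$$ $$H_t(n)=\sum_{1\leq k_1\leq\cdots\leq k_{2t}\leq n}\frac{q^{n+k_1+k_3+\cdots+k_{2t-1}}+q^{k_2+k_4+\cdots+k_{2t}}}{[n+k_1]_q[k_2]_q\cdots[k_{2t}]_q}.$$
   Context: Here $q$ is an indeterminate. $[m]_q=\frac{1-q^m}{1-q}$, and ${m\brack k}_q=\frac{[m]_q[m-1]_q\cdots[m-k+1]_q}{[1]_q[2]_q\cdots[k]_q}$ is the Gaussian $q$-binomial coefficient. Summation indices are integers. In $H_t(n)$ the first exponent is $n$ plus the sum of all odd-indexed $k_i$ ($i=1,3,\dots,2t-1$), the second exponent is the sum of all even-indexed $k_i$ ($i=2,4,\dots,2t$), and the denominator is $[n+k_1]_q\prod_{i=2}^{2t}[k_i]_q$. *)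

theory Defs
  imports
    "HOL-Computational_Algebra.Fraction_Field"
    "HOL-Computational_Algebra.Polynomial"
    "HOL-Library.FuncSet"
begin

text \<open>The indeterminate, as an element of the field of rational functions over the rationals.\<close>

definition qvar :: "rat poly fract" where
  "qvar = Fraction_Field.Fract [:0, 1:] 1"

definition qint :: "'a::field \<Rightarrow> nat \<Rightarrow> 'a" where
  "qint q m = (1 - q ^ m) / (1 - q)"

text \<open>For \<open>k > m\<close> the numerator contains the factor \<open>qint q 0 = 0\<close>, so the truncated
  subtraction is harmless.\<close>

definition qbinom :: "'a::field \<Rightarrow> nat \<Rightarrow> nat \<Rightarrow> 'a" where
  "qbinom q m k = (\<Prod>i<k. qint q (m - i)) / (\<Prod>i=1..k. qint q i)"

text \<open>The sequences \<open>1 \<le> k 1 \<le> \<dots> \<le> k r \<le> n\<close>. They are represented by functions that are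
  \<open>undefined\<close> outside \<open>{1..r}\<close>, so that each sequence is counted once and the set is finite.\<close>

definition weak_chains :: "nat \<Rightarrow> nat \<Rightarrow> (nat \<Rightarrow> nat) set" where
  "weak_chains r n = {k \<in> {1..r} \<rightarrow>\<^sub>E {1..n}. mono_on {1..r} k}"

definition F_sum :: "'a::field \<Rightarrow> nat \<Rightarrow> nat \<Rightarrow> 'a" where
  "F_sum q t n =
    (\<Sum>k\<in>weak_chains t n. q ^ (\<Sum>i=1..t. k i) / (\<Prod>i=1..t. (qint q (k i))\<^sup>2))"

definition G_sum :: "'a::field \<Rightarrow> nat \<Rightarrow> nat \<Rightarrow> 'a" where
  "G_sum q t n =
    (\<Sum>k=1..n. ((- 1) ^ (k - 1) * (1 + q ^ k) * q ^ ((k choose 2) + t * k) * qbinom q n k)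
      / ((qint q k) ^ (2 * t) * qbinom q (n + k) k))"

definition H_sum :: "'a::field \<Rightarrow> nat \<Rightarrow> nat \<Rightarrow> 'a" where
  "H_sum q t n =
    (\<Sum>k\<in>weak_chains (2 * t) n.
      (q ^ (n + (\<Sum>i | i \<in> {1..2 * t} \<and> odd i. k i)) + q ^ (\<Sum>i | i \<in> {1..2 * t} \<and> even i. k i))
      / (qint q (n + k 1) * (\<Prod>i=2..2 * t. qint q (k i))))"

end

theory Submission imports Defs begin

text \<open>
  All three sums satisfy the same recursion: with the value \<open>1\<close> at \<open>t = 0\<close> and \<open>n \<ge> 1\<close>,
  \<open>S (t+1) n - S (t+1) (n-1) = q^n / [n]\<^sup>2 * S t n\<close> and \<open>S (t+1) 0 = 0\<close>,
  and this determines them (\<open>F_sum_unique\<close>).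

  For \<open>F\<close> the recursion comes from splitting the sum by the value of the largest index.

  For \<open>G\<close> the dependence on \<open>n\<close> is only through the quotient \<open>c(n,k)\<close> of the two \<open>q\<close>-binomial
  coefficients, and \<open>[n]\<^sup>2 c(n-1,k) = [n-k][n+k] c(n,k)\<close>. Since
  \<open>[n]\<^sup>2 - [n-k][n+k] = q^(n-k) [k]\<^sup>2\<close>, taking the difference in \<open>n\<close> cancels one factor
  \<open>q^k / [k]\<^sup>2\<close> of the summand (\<open>G_sum_diff\<close>). At \<open>t = 0\<close> the sum telescopes (\<open>G_sum_0\<close>).

  The sum \<open>H\<close> has two parts, in which the factors \<open>q^k\<close> sit at the odd and at the even positions.
  The number \<open>n\<close> enters twice: in the factor of \<open>k\<^sub>1\<close> and as the bound for the last index. Changing it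
  in the first factor only makes the sum over \<open>k\<^sub>1 \<le> k\<^sub>2\<close> telescope; the chain becomes one shorter, so
  every other index changes the parity of its position and the two parts change roles, with a common
  factor \<open>- q^n / [n]\<close> (\<open>alt_sum_diff\<close>). Changing the bound adds the chains whose last
  index is \<open>n\<close>, again sums over chains one shorter, with factor \<open>q^n / [n]\<close> in both parts: in the
  one the power of \<open>q\<close> is the \<open>q^n\<close> in front, in the other it belongs to the last index. These
  contributions cancel, except for the chains of length one less that end in \<open>n\<close>, and these give \<open>q^n / [n]\<^sup>2\<close> times the sum for \<open>t\<close> (\<open>sym_sum_diff\<close>).

  The argument works in every field for every \<open>q\<close> that is not a root of unity.
\<close>

section \<open>Sums over weak chains as iterated sums\<close>

lemma weak_chains_0: "weak_chains 0 n = {\<lambda>_. undefined}"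
  by (auto simp: weak_chains_def)

lemma finite_weak_chains: "finite (weak_chains r n)"
  unfolding weak_chains_def
  by (rule finite_subset[of _ "{1..r} \<rightarrow>\<^sub>E {1..n}"]) (auto intro: finite_PiE)

lemma weak_chain_extend:
  assumes "m \<in> {1..n}" "k \<in> weak_chains r m"
  shows "k(Suc r := m) \<in> weak_chains (Suc r) n"
proof -
  have k: "k \<in> {1..r} \<rightarrow>\<^sub>E {1..m}" "mono_on {1..r} k"
    using assms by (auto simp: weak_chains_def)
  have b: "1 \<le> k i \<and> k i \<le> m" if "1 \<le> i" "i \<le> r" for i
    using PiE_mem[OF k(1), of i] that by auto
  have "k(Suc r := m) \<in> {1..Suc r} \<rightarrow>\<^sub>E {1..n}"
    using assms(1) b k(1) by (fastforce simp: PiE_def extensional_def le_Suc_eq)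
  moreover have "mono_on {1..Suc r} (k(Suc r := m))"
    using b k(2) by (auto simp: mono_on_def le_Suc_eq)
  ultimately show ?thesis by (simp add: weak_chains_def)
qed

lemma weak_chain_restrict:
  assumes "k \<in> weak_chains (Suc r) n"
  shows "k (Suc r) \<in> {1..n}" "k(Suc r := undefined) \<in> weak_chains r (k (Suc r))"
proof -
  have k: "k \<in> {1..Suc r} \<rightarrow>\<^sub>E {1..n}" "mono_on {1..Suc r} k"
    using assms by (auto simp: weak_chains_def)
  have b: "1 \<le> k i \<and> k i \<le> n" if "1 \<le> i" "i \<le> Suc r" for i
    using PiE_mem[OF k(1), of i] that by auto
  show "k (Suc r) \<in> {1..n}" using b[of "Suc r"] by simp
  have top: "k i \<le> k (Suc r)" if "1 \<le> i" "i \<le> r" for i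
    using mono_onD[OF k(2), of i "Suc r"] that by auto
  have "k(Suc r := undefined) \<in> {1..r} \<rightarrow>\<^sub>E {1..k (Suc r)}"
    using b top k(1) by (auto simp: PiE_def extensional_def)
  moreover have "mono_on {1..r} (k(Suc r := undefined))"
    using k(2) by (auto simp: mono_on_def)
  ultimately show "k(Suc r := undefined) \<in> weak_chains r (k (Suc r))"
    by (simp add: weak_chains_def)
qed

lemma weak_chain_outside: "k \<in> weak_chains r n \<Longrightarrow> k (Suc r) = undefined"
  by (auto simp: weak_chains_def PiE_def extensional_def)

text \<open>Removing the largest index of a chain leaves a chain bounded by that index.\<close>

lemma sum_weak_chains_Suc:
  fixes \<Phi> :: "(nat \<Rightarrow> nat) \<Rightarrow> 'a::comm_monoid_add"
  shows "(\<Sum>k\<in>weak_chains (Suc r) n. \<Phi> k)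
    = (\<Sum>m=1..n. \<Sum>k\<in>weak_chains r m. \<Phi> (k(Suc r := m)))"
proof -
  have "(\<Sum>m=1..n. \<Sum>k\<in>weak_chains r m. \<Phi> (k(Suc r := m)))
      = (\<Sum>(m, k)\<in>(SIGMA m:{1..n}. weak_chains r m). \<Phi> (k(Suc r := m)))"
    by (rule sum.Sigma) (auto simp: finite_weak_chains)
  also have "\<dots> = (\<Sum>k\<in>weak_chains (Suc r) n. \<Phi> k)"
    by (rule sum.reindex_bij_witness[where i = "\<lambda>k. (k (Suc r), k(Suc r := undefined))"
          and j = "\<lambda>(m, k). k(Suc r := m)"])
      (use weak_chain_extend weak_chain_restrict weak_chain_outside in
        \<open>auto simp: fun_upd_idem_iff\<close>)
  finally show ?thesis by simp
qed

text \<open>A sum over chains of length \<open>r\<close> bounded by \<open>M\<close>, with weight \<open>w i\<close> on the \<open>i\<close>-th index and an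
  additional weight \<open>g\<close> on the smallest one. For the empty chain the bound itself takes the place of
  the smallest index; with this convention the recursion holds from length \<open>0\<close> on.\<close>

primrec nested_sum ::
  "(nat \<Rightarrow> nat \<Rightarrow> 'a::comm_ring_1) \<Rightarrow> (nat \<Rightarrow> 'a) \<Rightarrow> nat \<Rightarrow> nat \<Rightarrow> 'a" where
  "nested_sum w g 0 M = g M"
| "nested_sum w g (Suc r) M = (\<Sum>m=1..M. w (Suc r) m * nested_sum w g r m)"

lemma prod_fun_upd_Suc:
  "(\<Prod>i=1..r. f i ((k(Suc r := m)) i)) = (\<Prod>i=1..r. f i (k i))"
  by (rule prod.cong) auto

lemma sum_weak_chains_eq_nested_sum:
  "(\<Sum>k\<in>weak_chains (Suc r) M. g (k 1) * (\<Prod>i=1..Suc r. w i (k i)))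
    = nested_sum w g (Suc r) M"
proof (induction r arbitrary: M)
  case 0
  show ?case
    unfolding sum_weak_chains_Suc by (simp add: weak_chains_0 mult.commute)
next
  case (Suc r)
  have split: "g ((k(Suc (Suc r) := m)) 1) * (\<Prod>i=1..Suc (Suc r). w i ((k(Suc (Suc r) := m)) i))
      = w (Suc (Suc r)) m * (g (k 1) * (\<Prod>i=1..Suc r. w i (k i)))" for m k
  proof -
    have "(\<Prod>i=1..Suc (Suc r). w i ((k(Suc (Suc r) := m)) i))
        = w (Suc (Suc r)) m * (\<Prod>i=1..Suc r. w i ((k(Suc (Suc r) := m)) i))"
      by (subst prod.nat_ivl_Suc') simp_all
    then show ?thesis
      by (simp only: prod_fun_upd_Suc) simp
  qed
  have "(\<Sum>k\<in>weak_chains (Suc (Suc r)) M. g (k 1) * (\<Prod>i=1..Suc (Suc r). w i (k i)))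
    = (\<Sum>m=1..M. \<Sum>k\<in>weak_chains (Suc r) m.
        w (Suc (Suc r)) m * (g (k 1) * (\<Prod>i=1..Suc r. w i (k i))))"
    by (simp only: sum_weak_chains_Suc[of _ "Suc r"] split)
  also have "\<dots> = (\<Sum>m=1..M. w (Suc (Suc r)) m * nested_sum w g (Suc r) m)"
    by (simp only: Suc.IH flip: sum_distrib_left)
  finally show ?case by simp
qed

section \<open>The common recursion\<close>

lemma F_sum_0: "F_sum q 0 n = 1"
  by (simp add: F_sum_def weak_chains_0)

lemma F_sum_Suc: "F_sum q (Suc t) n = (\<Sum>m=1..n. q ^ m / (qint q m)\<^sup>2 * F_sum q t m)"
proof -
  have chain: "F_sum q (Suc t) n
      = nested_sum (\<lambda>i m. q ^ m / (qint q m)\<^sup>2) (\<lambda>_. 1) (Suc t) n" for t n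
    unfolding F_sum_def sum_weak_chains_eq_nested_sum[where g = "\<lambda>_. 1", symmetric]
    by (simp only: power_sum prod_dividef mult_1)
  show ?thesis
  proof (cases t)
    case 0
    then show ?thesis by (simp add: chain F_sum_0)
  next
    case (Suc s)
    then show ?thesis by (simp only: Suc chain nested_sum.simps(2)[of _ _ "Suc s"])
  qed
qed

text \<open>The recursion is only asked to start with \<open>1\<close> for \<open>n \<ge> 1\<close>, as \<open>G_sum\<close> is an empty sum
  at \<open>n = 0\<close>.\<close>

lemma F_sum_unique:
  fixes S :: "nat \<Rightarrow> nat \<Rightarrow> 'a::field"
  assumes base: "\<And>n. n \<ge> 1 \<Longrightarrow> S 0 n = 1"
    and zero: "\<And>t. S (Suc t) 0 = 0"
    and step: "\<And>t n. S (Suc t) (Suc n) - S (Suc t) n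
      = q ^ Suc n / (qint q (Suc n))\<^sup>2 * S t (Suc n)"
    and "n \<ge> 1"
  shows "S t n = F_sum q t n"
  using \<open>n \<ge> 1\<close>
proof (induction t arbitrary: n)
  case 0
  then show ?case by (simp add: base F_sum_0)
next
  case (Suc t)
  have "S (Suc t) n = (\<Sum>m=1..n. q ^ m / (qint q m)\<^sup>2 * S t m)" for n
  proof (induction n)
    case 0
    then show ?case by (simp add: zero)
  next
    case (Suc n)
    then show ?case using step[of t n] by (simp add: algebra_simps)
  qed
  then show ?case by (simp add: F_sum_Suc Suc.IH)
qed

section \<open>The alternating sum\<close>

lemma qint_0 [simp]: "qint q 0 = 0"
  by (simp add: qint_def)

locale not_root_of_unity =
  fixes q :: "'a::field"
  assumes power_neq_1: "\<And>m. m \<ge> 1 \<Longrightarrow> q ^ m \<noteq> 1"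
begin

lemma qint_nonzero: "m \<ge> 1 \<Longrightarrow> qint q m \<noteq> 0"
  using power_neq_1[of m] power_neq_1[of 1] by (simp add: qint_def)

lemma qint_eq: "qint q m * (1 - q) = 1 - q ^ m"
  using power_neq_1[of 1] by (simp add: qint_def)

lemma qint_add: "qint q (a + b) = qint q a + q ^ a * qint q b"
  using power_neq_1[of 1] by (simp add: qint_def field_simps power_add)

text \<open>Cancelling the factorials gives \<open>([n]!)\<^sup>2 / ([n-k]! [n+k]!)\<close>, which is
  the ratio of the \<open>q\<close>-binomial coefficient \<open>2n\<close> over \<open>n+k\<close> to the central one.\<close>

definition central_ratio :: "nat \<Rightarrow> nat \<Rightarrow> 'a" where
  "central_ratio n k = qbinom q n k / qbinom q (n + k) k"

lemma central_ratio_eq: "central_ratio n k = (\<Prod>i<k. qint q (n - i) / qint q (n + Suc i))"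
proof -
  have "(\<Prod>i=1..k. qint q i) \<noteq> 0"
    by (auto simp: qint_nonzero)
  then have "central_ratio n k = (\<Prod>i<k. qint q (n - i)) / (\<Prod>i<k. qint q (n + k - i))"
    by (simp add: central_ratio_def qbinom_def)
  also have "(\<Prod>i<k. qint q (n + k - i)) = (\<Prod>i<k. qint q (n + Suc i))"
    by (rule prod.reindex_bij_witness[where i = "\<lambda>i. k - Suc i" and j = "\<lambda>i. k - Suc i"])
      (auto intro!: arg_cong[where f = "qint q"])
  finally show ?thesis by (simp add: prod_dividef)
qed

lemma central_ratio_0: "central_ratio n 0 = 1"
  by (simp add: central_ratio_eq)

lemma central_ratio_Suc_right:
  "central_ratio n (Suc k) = central_ratio n k * qint q (n - k) / qint q (Suc n + k)"
  by (simp add: central_ratio_eq)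

lemma central_ratio_Suc_left:
  assumes "k \<le> Suc n"
  shows "(qint q (Suc n))\<^sup>2 * central_ratio n k
    = qint q (Suc n - k) * qint q (Suc n + k) * central_ratio (Suc n) k"
  using assms
proof (induction k)
  case 0
  then show ?case by (simp add: central_ratio_0 power2_eq_square)
next
  case (Suc k)
  have nz: "qint q (Suc n + k) \<noteq> 0" "qint q (Suc (Suc n) + k) \<noteq> 0"
    by (simp_all add: qint_nonzero)
  have "(qint q (Suc n))\<^sup>2 * central_ratio n (Suc k)
      = (qint q (Suc n))\<^sup>2 * central_ratio n k * qint q (n - k) / qint q (Suc n + k)"
    by (simp add: central_ratio_Suc_right)
  also have "\<dots> = qint q (n - k) * (qint q (Suc n - k) * central_ratio (Suc n) k)"
    using Suc nz by (simp add: field_simps)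
  also have "\<dots> = qint q (Suc n - Suc k) * qint q (Suc n + Suc k) * central_ratio (Suc n) (Suc k)"
    using nz by (simp add: central_ratio_Suc_right)
  finally show ?case .
qed

lemma qint_square_minus:
  assumes "k \<le> n"
  shows "(qint q n)\<^sup>2 - qint q (n - k) * qint q (n + k) = q ^ (n - k) * (qint q k)\<^sup>2"
proof -
  obtain d where n: "n = k + d"
    using assms le_Suc_ex by blast
  have "(qint q n)\<^sup>2 - qint q (n - k) * qint q (n + k)
      = ((1 - q ^ (k + d))\<^sup>2 - (1 - q ^ d) * (1 - q ^ (k + d + k))) / (1 - q)\<^sup>2"
    by (simp only: n qint_def power2_eq_square times_divide_times_eq diff_add_inverse
        flip: diff_divide_distrib)
  also have "(1 - q ^ (k + d))\<^sup>2 - (1 - q ^ d) * (1 - q ^ (k + d + k)) = q ^ d * (1 - q ^ k)\<^sup>2"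
    by (simp add: power_add power2_eq_square algebra_simps)
  finally show ?thesis
    by (simp add: n qint_def power_divide)
qed

text \<open>The factor \<open>[k]\<^sup>2\<close> is what lowers \<open>t\<close> by one in the sum \<open>G\<close>.\<close>

lemma central_ratio_diff:
  assumes "k \<le> Suc n"
  shows "central_ratio (Suc n) k - central_ratio n k
    = q ^ (Suc n - k) * (qint q k)\<^sup>2 / (qint q (Suc n))\<^sup>2 * central_ratio (Suc n) k"
proof -
  have nz: "(qint q (Suc n))\<^sup>2 \<noteq> 0" by (simp add: qint_nonzero)
  have "(qint q (Suc n))\<^sup>2 * (central_ratio (Suc n) k - central_ratio n k)
    = ((qint q (Suc n))\<^sup>2 - qint q (Suc n - k) * qint q (Suc n + k)) * central_ratio (Suc n) k"
    by (simp only: right_diff_distrib left_diff_distrib central_ratio_Suc_left[OF assms])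
  also have "\<dots> = q ^ (Suc n - k) * (qint q k)\<^sup>2 * central_ratio (Suc n) k"
    by (simp only: qint_square_minus[OF assms])
  finally show ?thesis using nz by (simp add: field_simps)
qed

lemma central_ratio_self_Suc: "central_ratio n (Suc n) = 0"
  by (simp add: central_ratio_Suc_right)

lemma G_sum_eq:
  "G_sum q t n = (\<Sum>k=1..n. (- 1) ^ (k - 1) * (1 + q ^ k) * q ^ ((k choose 2) + t * k)
    / qint q k ^ (2 * t) * central_ratio n k)"
  by (simp add: G_sum_def central_ratio_def)

lemma G_sum_diff:
  "G_sum q (Suc t) (Suc n) - G_sum q (Suc t) n
    = q ^ Suc n / (qint q (Suc n))\<^sup>2 * G_sum q t (Suc n)"
proof -
  define a where "a t k = (- 1) ^ (k - 1) * (1 + q ^ k) * q ^ ((k choose 2) + t * k)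
    / qint q k ^ (2 * t)" for t k
  have G: "G_sum q t n = (\<Sum>k=1..n. a t k * central_ratio n k)" for t n
    by (simp add: G_sum_eq a_def)
  \<comment> \<open>The added term is zero; now both sums have the same range.\<close>
  have "G_sum q (Suc t) n = (\<Sum>k=1..Suc n. a (Suc t) k * central_ratio n k)"
    by (simp add: G central_ratio_self_Suc)
  then have "G_sum q (Suc t) (Suc n) - G_sum q (Suc t) n
    = (\<Sum>k=1..Suc n. a (Suc t) k * (central_ratio (Suc n) k - central_ratio n k))"
    by (simp only: G right_diff_distrib sum_subtractf)
  also have "\<dots> = (\<Sum>k=1..Suc n. q ^ Suc n / (qint q (Suc n))\<^sup>2 *
      (a t k * central_ratio (Suc n) k))"
  proof (rule sum.cong)
    fix k assume k: "k \<in> {1..Suc n}"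
    then have "q ^ Suc n = q ^ k * q ^ (Suc n - k)"
      by (simp flip: power_add)
    moreover have "a (Suc t) k * (qint q k)\<^sup>2 = q ^ k * a t k"
      using k qint_nonzero[of k]
      by (simp add: a_def power_add power2_eq_square)
    ultimately show "a (Suc t) k * (central_ratio (Suc n) k - central_ratio n k)
      = q ^ Suc n / (qint q (Suc n))\<^sup>2 * (a t k * central_ratio (Suc n) k)"
      using k by (simp add: central_ratio_diff ac_simps)
  qed simp
  finally show ?thesis
    by (simp only: G sum_distrib_left)
qed

text \<open>Since \<open>(1 + q^k) q^(k choose 2)\<close> collects the terms of \<open>k\<close> and \<open>-k\<close>, this is the
  vanishing of the alternating sum of the \<open>q\<close>-binomial coefficients of row \<open>2n\<close>. As there, the
  partial sums have a closed form: the sum of the first \<open>m\<close> terms is \<open>1 - X m\<close>.\<close>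

lemma G_sum_0:
  assumes "n \<ge> 1"
  shows "G_sum q 0 n = 1"
proof -
  define X where "X m = (- 1) ^ m * q ^ (Suc m choose 2) * central_ratio n m * qint q (n - m)
    / qint q n" for m
  have nz: "qint q n \<noteq> 0" using assms by (rule qint_nonzero)
  have "(\<Sum>k=1..m. (- 1) ^ (k - 1) * (1 + q ^ k) * q ^ (k choose 2) * central_ratio n k)
    = 1 - X m" if "m \<le> n" for m
    using that
  proof (induction m)
    case 0
    then show ?case using nz by (simp add: X_def central_ratio_0 binomial_eq_0)
  next
    case (Suc m)
    have qn: "q ^ n = q ^ Suc m * q ^ (n - Suc m)"
      using Suc.prems by (metis le_add_diff_inverse power_add)
    have 1: "central_ratio n m * qint q (n - m) = central_ratio n (Suc m) * qint q (Suc n + m)"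
      by (simp add: central_ratio_Suc_right qint_nonzero)
    have 2: "q ^ Suc m * qint q (n - Suc m) + qint q (Suc n + m) = (1 + q ^ Suc m) * qint q n"
    proof -
      have "(q ^ Suc m * qint q (n - Suc m) + qint q (Suc n + m)) * (1 - q)
          = q ^ Suc m * (1 - q ^ (n - Suc m)) + (1 - q ^ (Suc n + m))"
        by (simp only: distrib_right mult.assoc qint_eq)
      also have "\<dots> = (1 + q ^ Suc m) * (1 - q ^ n)"
        using qn by (simp add: power_add algebra_simps)
      also have "\<dots> = (1 + q ^ Suc m) * qint q n * (1 - q)"
        by (simp only: mult.assoc qint_eq)
      finally show ?thesis using power_neq_1[of 1] by simp
    qed
    have 3: "q ^ (Suc (Suc m) choose 2) = q ^ (Suc m choose 2) * q ^ Suc m"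
      by (simp add: numeral_2_eq_2 power_add)
    have "X m - X (Suc m) = (- 1) ^ m * q ^ (Suc m choose 2) * central_ratio n (Suc m) *
        (q ^ Suc m * qint q (n - Suc m) + qint q (Suc n + m)) / qint q n"
      unfolding X_def 3 mult.assoc[of _ "central_ratio n m"] 1
      by (simp add: algebra_simps add_divide_distrib)
    also have "\<dots> = (- 1) ^ m * (1 + q ^ Suc m) * q ^ (Suc m choose 2) * central_ratio n (Suc m)"
      unfolding 2 using nz by simp
    finally show ?case using Suc by (simp add: algebra_simps)
  qed
  from this[of n] show ?thesis by (simp add: G_sum_eq X_def)
qed

lemma G_sum_eq_F_sum: "n \<ge> 1 \<Longrightarrow> G_sum q t n = F_sum q t n"
  by (rule F_sum_unique[of "G_sum q", OF G_sum_0 _ G_sum_diff]) (simp_all add: G_sum_def)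

section \<open>The sum with alternating exponents\<close>

text \<open>The flag \<open>p\<close> tells whether the powers of \<open>q\<close> sit at the odd positions (\<open>True\<close>) or at the even
  ones (\<open>False\<close>).\<close>

definition alt_weight :: "bool \<Rightarrow> nat \<Rightarrow> nat \<Rightarrow> 'a" where
  "alt_weight p i m = q ^ (if odd i = p then m else 0) / qint q m"

text \<open>The extra factor \<open>[k\<^sub>1] / [n + k\<^sub>1]\<close> turns the weight \<open>1 / [k\<^sub>1]\<close> of the first index into
  \<open>1 / [n + k\<^sub>1]\<close>. Keeping \<open>n\<close> apart from the bound of the indices allows to vary them one at a
  time.\<close>

definition alt_sum :: "bool \<Rightarrow> nat \<Rightarrow> nat \<Rightarrow> nat \<Rightarrow> 'a" where
  "alt_sum p n r = nested_sum (alt_weight p) (\<lambda>m. qint q m / qint q (n + m)) r"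

text \<open>The part of the numerator of \<open>H\<close> that does not depend on the indices.\<close>

definition alt_factor :: "bool \<Rightarrow> nat \<Rightarrow> 'a" where
  "alt_factor p n = q ^ (if p then n else 0)"

lemma alt_sum_0: "alt_sum p n 0 M = qint q M / qint q (n + M)"
  by (simp add: alt_sum_def)

lemma alt_sum_Suc:
  "alt_sum p n (Suc r) M = (\<Sum>m=1..M. alt_weight p (Suc r) m * alt_sum p n r m)"
  by (simp add: alt_sum_def)

lemma power_div_qint: "m \<ge> 1 \<Longrightarrow> q ^ m / qint q m = 1 / qint q m - (1 - q)"
  using qint_nonzero[of m] qint_eq[of m] by (simp add: field_simps)

text \<open>For chains of length one, \<open>q^(n+m) / [n+m]\<close> and \<open>1 / [n+m]\<close> differ by a constant, so for both
  values of \<open>p\<close> the difference in \<open>n\<close> is \<open>1 / [n+1+m] - 1 / [n+m]\<close>, which telescopes over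
  \<open>m\<close>. The result has the form of an empty chain, independent of \<open>p\<close>. Longer chains
  inherit the identity term by term; as the chain on the right is one shorter, its index weights
  are those of the opposite parity.\<close>

lemma alt_sum_diff:
  "alt_factor p (Suc n) * alt_sum p (Suc n) (Suc r) M - alt_factor p n * alt_sum p n (Suc r) M
    = - (q ^ Suc n / qint q (Suc n)) * alt_sum (\<not> p) (Suc n) r M"
proof (induction r arbitrary: M)
  case 0
  have *: "alt_factor p n * (alt_weight p (Suc 0) m * alt_sum p n 0 m)
      = 1 / qint q (n + m) - (if p then 1 - q else 0)" if "m \<ge> 1" for n m
    using that power_div_qint[of "n + m"] qint_nonzero[of m]
    by (simp add: alt_factor_def alt_weight_def alt_sum_0 power_add)
  have "alt_factor p (Suc n) * alt_sum p (Suc n) (Suc 0) M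
      - alt_factor p n * alt_sum p n (Suc 0) M
    = (\<Sum>m=1..M. 1 / qint q (Suc n + m) - 1 / qint q (n + m))"
    unfolding alt_sum_Suc sum_distrib_left sum_subtractf[symmetric]
    by (rule sum.cong) (simp_all add: *)
  also have "\<dots> = 1 / qint q (Suc n + M) - 1 / qint q (Suc n)"
    by (induction M) simp_all
  also have "\<dots> = - (q ^ Suc n / qint q (Suc n)) * (qint q M / qint q (Suc n + M))"
  proof -
    have "1 / qint q (Suc n + M) - 1 / qint q (Suc n)
        = (qint q (Suc n) - qint q (Suc n + M)) / (qint q (Suc n) * qint q (Suc n + M))"
      using qint_nonzero[of "Suc n"] qint_nonzero[of "Suc n + M"]
      by (simp add: diff_divide_distrib)
    also have "qint q (Suc n) - qint q (Suc n + M) = - (q ^ Suc n * qint q M)"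
      by (simp only: qint_add) simp
    finally show ?thesis by simp
  qed
  finally show ?case by (simp add: alt_sum_0)
next
  case (Suc r)
  have swap: "alt_weight p (Suc (Suc r)) m = alt_weight (\<not> p) (Suc r) m" for m
    by (auto simp: alt_weight_def)
  have "alt_factor p (Suc n) * alt_sum p (Suc n) (Suc (Suc r)) M
      - alt_factor p n * alt_sum p n (Suc (Suc r)) M
    = (\<Sum>m=1..M. alt_weight p (Suc (Suc r)) m *
        (alt_factor p (Suc n) * alt_sum p (Suc n) (Suc r) m
          - alt_factor p n * alt_sum p n (Suc r) m))"
    unfolding alt_sum_Suc[of _ _ "Suc r"] sum_distrib_left sum_subtractf[symmetric]
    by (rule sum.cong) (simp_all add: algebra_simps)
  also have "\<dots> = - (q ^ Suc n / qint q (Suc n)) * alt_sum (\<not> p) (Suc n) (Suc r) M"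
    unfolding Suc.IH swap alt_sum_Suc[of "\<not> p"] sum_distrib_left
    by (rule sum.cong) simp_all
  finally show ?case .
qed

text \<open>This agrees with \<open>H\<close> for \<open>t \<ge> 1\<close>, and at \<open>t = 0\<close> it has the right initial value
  \<open>(1 + q^n) [n] / [2n] = 1\<close>.\<close>

definition sym_sum :: "nat \<Rightarrow> nat \<Rightarrow> 'a" where
  "sym_sum t n = q ^ n * alt_sum True n (2 * t) n + alt_sum False n (2 * t) n"

lemma alt_sum_Suc_Suc:
  "alt_sum p n (Suc r) (Suc M)
    = alt_sum p n (Suc r) M + alt_weight p (Suc r) (Suc M) * alt_sum p n r (Suc M)"
  by (simp add: alt_sum_Suc)

text \<open>Varying \<open>n\<close> in the first factor contributes \<open>-c\<close> times the sums of odd length bounded by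
  \<open>n\<close>, and raising the bound contributes \<open>c\<close> times the same sums bounded by \<open>n + 1\<close>. Only the chains
  of odd length that end in \<open>n + 1\<close> survive.\<close>

lemma sym_sum_diff:
  "sym_sum (Suc t) (Suc n) - sym_sum (Suc t) n
    = q ^ Suc n / (qint q (Suc n))\<^sup>2 * sym_sum t (Suc n)"
proof -
  define N where "N = Suc n"
  define c where "c = q ^ N / qint q N"
  define A where "A = alt_sum True"
  define B where "B = alt_sum False"
  have A_diff: "q ^ N * A N (Suc (Suc (2 * t))) n - q ^ n * A n (Suc (Suc (2 * t))) n
      = - c * B N (Suc (2 * t)) n"
    using alt_sum_diff[of True n "Suc (2 * t)" n]
    by (simp add: alt_factor_def A_def B_def N_def c_def)
  have B_diff: "B N (Suc (Suc (2 * t))) n - B n (Suc (Suc (2 * t))) n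
      = - c * A N (Suc (2 * t)) n"
    using alt_sum_diff[of False n "Suc (2 * t)" n]
    by (simp add: alt_factor_def A_def B_def N_def c_def)
  have A_even: "q ^ N * A N (Suc (Suc (2 * t))) N
      = q ^ N * A N (Suc (Suc (2 * t))) n + c * A N (Suc (2 * t)) N"
    unfolding A_def N_def c_def alt_sum_Suc_Suc[of _ _ "Suc (2 * t)"]
    by (simp add: alt_weight_def algebra_simps)
  have B_even: "B N (Suc (Suc (2 * t))) N = B N (Suc (Suc (2 * t))) n + c * B N (Suc (2 * t)) N"
    unfolding B_def N_def c_def alt_sum_Suc_Suc[of _ _ "Suc (2 * t)"]
    by (simp add: alt_weight_def)
  have A_odd: "A N (Suc (2 * t)) N = A N (Suc (2 * t)) n + c * A N (2 * t) N"
    unfolding A_def N_def c_def alt_sum_Suc_Suc by (simp add: alt_weight_def)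
  have B_odd: "B N (Suc (2 * t)) N = B N (Suc (2 * t)) n + 1 / qint q N * B N (2 * t) N"
    unfolding B_def N_def alt_sum_Suc_Suc by (simp add: alt_weight_def)
  have "sym_sum (Suc t) N - sym_sum (Suc t) n
    = (q ^ N * A N (Suc (Suc (2 * t))) n - q ^ n * A n (Suc (Suc (2 * t))) n)
      + (B N (Suc (Suc (2 * t))) n - B n (Suc (Suc (2 * t))) n)
      + c * A N (Suc (2 * t)) N + c * B N (Suc (2 * t)) N"
    by (simp add: sym_sum_def A_even B_even flip: A_def B_def)
  also have "\<dots> = c * (A N (Suc (2 * t)) N - A N (Suc (2 * t)) n)
      + c * (B N (Suc (2 * t)) N - B N (Suc (2 * t)) n)"
    unfolding A_diff B_diff by (simp add: algebra_simps)
  also have "\<dots> = c / qint q N * (q ^ N * A N (2 * t) N + B N (2 * t) N)"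
    unfolding A_odd B_odd by (simp add: c_def algebra_simps)
  also have "\<dots> = q ^ N / (qint q N)\<^sup>2 * sym_sum t N"
    by (simp add: c_def sym_sum_def A_def B_def power2_eq_square)
  finally show ?thesis by (simp add: N_def)
qed

lemma sym_sum_0:
  assumes "n \<ge> 1"
  shows "sym_sum 0 n = 1"
proof -
  have "qint q (n + n) = (1 + q ^ n) * qint q n"
    by (simp add: qint_add algebra_simps)
  moreover have "qint q (n + n) \<noteq> 0" using assms by (simp add: qint_nonzero)
  moreover have "sym_sum 0 n = (1 + q ^ n) * qint q n / qint q (n + n)"
    by (simp add: sym_sum_def alt_sum_0 algebra_simps add_divide_distrib)
  ultimately show ?thesis by simp
qed

lemma sym_sum_eq_F_sum: "n \<ge> 1 \<Longrightarrow> sym_sum t n = F_sum q t n"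
  by (rule F_sum_unique[of sym_sum])
    (simp_all add: sym_sum_0 sym_sum_diff, simp add: sym_sum_def alt_sum_Suc)

lemma alt_sum_eq:
  "alt_sum p n (Suc r) M = (\<Sum>k\<in>weak_chains (Suc r) M.
    q ^ (\<Sum>i | i \<in> {1..Suc r} \<and> odd i = p. k i)
      / (qint q (n + k 1) * (\<Prod>i=2..Suc r. qint q (k i))))"
proof -
  have "alt_sum p n (Suc r) M = (\<Sum>k\<in>weak_chains (Suc r) M.
      qint q (k 1) / qint q (n + k 1) * (\<Prod>i=1..Suc r. alt_weight p i (k i)))"
    unfolding alt_sum_def
    by (rule sum_weak_chains_eq_nested_sum[where g = "\<lambda>m. qint q m / qint q (n + m)", symmetric])
  also have "\<dots> = (\<Sum>k\<in>weak_chains (Suc r) M.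
    q ^ (\<Sum>i | i \<in> {1..Suc r} \<and> odd i = p. k i)
      / (qint q (n + k 1) * (\<Prod>i=2..Suc r. qint q (k i))))"
  proof (rule sum.cong)
    fix k assume "k \<in> weak_chains (Suc r) M"
    then have "k \<in> {1..Suc r} \<rightarrow>\<^sub>E {1..M}" by (simp add: weak_chains_def)
    then have "k 1 \<in> {1..M}" by (rule PiE_mem) simp
    then have nz: "qint q (k 1) \<noteq> 0" by (simp add: qint_nonzero)
    have num: "(\<Prod>i=1..Suc r. q ^ (if odd i = p then k i else 0))
        = q ^ (\<Sum>i | i \<in> {1..Suc r} \<and> odd i = p. k i)"
      by (simp only: power_sum[symmetric] sum.inter_filter[OF finite_atLeastAtMost])
    have den: "(\<Prod>i=1..Suc r. qint q (k i)) = qint q (k 1) * (\<Prod>i=2..Suc r. qint q (k i))"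
      by (subst prod.atLeast_Suc_atMost) (simp_all add: numeral_2_eq_2)
    show "qint q (k 1) / qint q (n + k 1) * (\<Prod>i=1..Suc r. alt_weight p i (k i))
      = q ^ (\<Sum>i | i \<in> {1..Suc r} \<and> odd i = p. k i)
      / (qint q (n + k 1) * (\<Prod>i=2..Suc r. qint q (k i)))"
      unfolding alt_weight_def prod_dividef num den using nz by simp
  qed simp
  finally show ?thesis .
qed

lemma H_sum_eq_sym_sum:
  assumes "t \<ge> 1"
  shows "H_sum q t n = sym_sum t n"
proof -
  obtain r where r: "2 * t = Suc r"
    using assms by (cases "2 * t") auto
  show ?thesis
    unfolding H_sum_def sym_sum_def r alt_sum_eq
    by (simp add: sum_distrib_left power_add add_divide_distrib sum.distrib)
qed

end

section \<open>The indeterminate\<close>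

lemma qvar_power: "qvar ^ m = Fraction_Field.Fract (monom 1 m) 1"
  by (induction m) (simp_all add: qvar_def One_fract_def monom_Suc monom_0 one_pCons)

interpretation qvar: not_root_of_unity qvar
proof
  fix m :: nat assume "m \<ge> 1"
  show "qvar ^ m \<noteq> 1"
  proof
    assume "qvar ^ m = 1"
    then have "monom 1 m = (1 :: rat poly)"
      by (simp add: qvar_power One_fract_def eq_fract)
    then have "degree (monom (1 :: rat) m) = 0" by simp
    with \<open>m \<ge> 1\<close> show False by (simp add: degree_monom_eq)
  qed
qed

theorem theorem4p1:
  fixes n t :: nat
  assumes "1 \<le> n" and "1 \<le> t"
  shows "F_sum qvar t n = G_sum qvar t n \<and> G_sum qvar t n = H_sum qvar t n"
  using assms
  by (simp add: qvar.G_sum_eq_F_sum qvar.H_sum_eq_sym_sum qvar.sym_sum_eq_F_sum)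

end
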